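(* Assume that $A,B\in\mathrm{SL}(2,\mathbb{R})$ are hyperbolic matrices such that $C(A,B)$ is well-defined, $C(A,B)>1$ and $\lvert \mathrm{tr}(A)\rvert=\lvert \mathrm{tr}(B)\rvert=t$. Then $\{A,B\}$ is dominated if and only if $\tfrac{1}{2}t>\sqrt{C(A,B)}$.
   Context: $\mathrm{SL}(2,\mathbb{R})$ is equipped with an operator norm $\lVert\cdot\rVert$. A finite set $\{A_1,\dots,A_N\}\subset\mathrm{SL}(2,\mathbb{R})$ is called dominated if there exist constants $C>0$ and $\lambda>1$ such that $\lVert A_{i_n}A_{i_{n-1}}\cdots A_{i_1}\rVert\geq C\lambda^n$ for any sequence $(i_j)\subset\{1,2,\dots,N\}$ and all $n\in\mathbb{N}$. A non-identity matrix $A\in\mathrm{SL}(2,\mathbb{R})$ is hyperbolic if $\lvert\mathrm{tr}(A)\rvert>2$. A hyperbolic matrix has two eigenvalues $\lvert\lambda_u(A)\rvert>\lvert\lambda_s(A)\rvert$, with distinct corresponding eigenvectors $u(A),s(A)\in\mathbb{R}\mathbb{P}^1$ (respectively). $\mathbb{R}\mathbb{P}^1$ is identified with $\mathbb{R}\cup\{\infty\}$ (the line spanned by $(x,y)^T$ corresponds to $x/y$), so that $\begin{pmatrix}a&b\\c&d\end{pmatrix}$ acts by $x\mapsto\frac{ax+b}{cx+d}$. For hyperbolic $A,B\in\mathrm{SL}(2,\mathbb{R})$ the cross-ratio is \[ C(A,B)=\frac{u(A)-u(B)}{u(A)-s(B)}\cdot\frac{s(A)-s(B)}{s(A)-u(B)},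 \] with the standard conventions at infinity (if one of the points is $\infty$, the differences containing it are omitted; $C(A,B)=0$ if $u(A)=u(B)$ or $s(A)=s(B)$ and the cross-ratio is well-defined). It is well-defined exactly when $u(A)\neq s(B)$ and $u(B)\neq s(A)$. *)

theory Defs
  imports "HOL-Analysis.Analysis"
begin

definition SL2 :: "(real^2^2) set" where
  "SL2 = {A. det A = 1}"

definition is_vector_norm :: "(real^2 \<Rightarrow> real) \<Rightarrow> bool" where
  "is_vector_norm \<nu> \<longleftrightarrow>
     (\<forall>x. 0 \<le> \<nu> x) \<and> (\<forall>x. \<nu> x = 0 \<longleftrightarrow> x = 0) \<and>
     (\<forall>c x. \<nu> (c *\<^sub>R x) = \<bar>c\<bar> * \<nu> x) \<and> (\<forall>x y. \<nu> (x + y) \<le> \<nu> x + \<nu> y)"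

text \<open>
  The norm on matrices may be the operator norm induced by any vector norm on the plane; the
  library's \<^const>\<open>onorm\<close> covers only the Euclidean one.
\<close>

definition operator_norm :: "(real^2 \<Rightarrow> real) \<Rightarrow> real^2^2 \<Rightarrow> real" where
  "operator_norm \<nu> A = (SUP x\<in>{x. x \<noteq> 0}. \<nu> (A *v x) / \<nu> x)"

text \<open>
  With sequences indexed from 0, \<open>matrix_product M n\<close> is
  \<open>M (n - 1) ** \<dots> ** M 1 ** M 0\<close>, later factors on the left.
\<close>

primrec matrix_product :: "(nat \<Rightarrow> real^2^2) \<Rightarrow> nat \<Rightarrow> real^2^2" where
  "matrix_product M 0 = mat 1"
| "matrix_product M (Suc n) = M n ** matrix_product M n"

definition dominated :: "(real^2 \<Rightarrow> real) \<Rightarrow> (real^2^2) set \<Rightarrow> bool" where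
  "dominated \<nu> S \<longleftrightarrow> finite S \<and> S \<subseteq> SL2 \<and>
     (\<exists>C>0. \<exists>l>1. \<forall>M. (\<forall>j. M j \<in> S) \<longrightarrow>
        (\<forall>n. operator_norm \<nu> (matrix_product M n) \<ge> C * l ^ n))"

definition hyperbolic :: "real^2^2 \<Rightarrow> bool" where
  "hyperbolic A \<longleftrightarrow> A \<in> SL2 \<and> A \<noteq> mat 1 \<and> \<bar>trace A\<bar> > 2"

definition eigenvalue :: "real^2^2 \<Rightarrow> real \<Rightarrow> bool" where
  "eigenvalue A l \<longleftrightarrow> (\<exists>v. v \<noteq> 0 \<and> A *v v = l *\<^sub>R v)"

definition lambda_u :: "real^2^2 \<Rightarrow> real" where
  "lambda_u A = (THE l. eigenvalue A l \<and> (\<forall>m. eigenvalue A m \<and> m \<noteq> l \<longrightarrow> \<bar>l\<bar> > \<bar>m\<bar>))"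

definition lambda_s :: "real^2^2 \<Rightarrow> real" where
  "lambda_s A = (THE l. eigenvalue A l \<and> (\<forall>m. eigenvalue A m \<and> m \<noteq> l \<longrightarrow> \<bar>l\<bar> < \<bar>m\<bar>))"

text \<open>The real projective line as \<open>\<real> \<union> {\<infinity>}\<close>.\<close>

datatype rp1 = Fin real | Infty

definition line_of :: "real^2 \<Rightarrow> rp1" where
  "line_of v = (if v $ 2 = 0 then Infty else Fin (v $ 1 / v $ 2))"

definition eigenline :: "real^2^2 \<Rightarrow> real \<Rightarrow> rp1" where
  "eigenline A l = (THE p. \<exists>v. v \<noteq> 0 \<and> A *v v = l *\<^sub>R v \<and> p = line_of v)"

definition u_dir :: "real^2^2 \<Rightarrow> rp1" where
  "u_dir A = eigenline A (lambda_u A)"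

definition s_dir :: "real^2^2 \<Rightarrow> rp1" where
  "s_dir A = eigenline A (lambda_s A)"

text \<open>Omitting a difference that contains \<open>\<infinity>\<close> amounts to replacing it by 1.\<close>

fun rp1_diff :: "rp1 \<Rightarrow> rp1 \<Rightarrow> real" where
  "rp1_diff (Fin x) (Fin y) = x - y"
| "rp1_diff _ _ = 1"

definition cross_ratio_defined :: "real^2^2 \<Rightarrow> real^2^2 \<Rightarrow> bool" where
  "cross_ratio_defined A B \<longleftrightarrow> u_dir A \<noteq> s_dir B \<and> u_dir B \<noteq> s_dir A"

text \<open>
  The first case matters only when the coinciding points are both \<open>\<infinity>\<close>; otherwise the quotient
  already vanishes.
\<close>

definition cross_ratio :: "real^2^2 \<Rightarrow> real^2^2 \<Rightarrow> real" where
  "cross_ratio A B =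
     (if u_dir A = u_dir B \<or> s_dir A = s_dir B then 0
      else rp1_diff (u_dir A) (u_dir B) / rp1_diff (u_dir A) (s_dir B) *
           (rp1_diff (s_dir A) (s_dir B) / rp1_diff (s_dir A) (u_dir B)))"

end

theory Submission
  imports Defs
begin

text \<open>
  Write \<open>\<tau> = t / 2\<close>. Since the cross-ratio exceeds 1, the eigenlines occur in the cyclic order
  \<open>u(A), s(A), u(B), s(B)\<close> or its reverse, so a half-turn of the projective line exchanges \<open>u(A)\<close> with \<open>u(B)\<close> and
  \<open>s(A)\<close> with \<open>s(B)\<close>. As the traces agree up to sign, this half-turn conjugates \<open>A\<close> to \<open>\<plusminus>B\<close>. In a
  basis in which it is the quarter turn of the plane, the matrices become, up to sign,
  \<open>(\<tau>, \<beta>; \<alpha>, \<tau>)\<close> and \<open>(\<tau>, -\<alpha>; -\<beta>, \<tau>)\<close> with \<open>0 < \<beta> < \<alpha>\<close> and \<open>\<alpha> \<beta> = \<tau>\<^sup>2 - 1\<close>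
  (\<open>hyperbolic_pair_normal_form\<close>). The cross-ratio \<open>C\<close> enters only through
  \<open>(\<alpha> - \<beta>)\<^sup>2 (C - 1) = 4 (\<tau>\<^sup>2 - 1)\<close>, so that \<open>\<tau> > sqrt C\<close> means exactly \<open>\<alpha> - \<beta> > 2\<close>.

  The number \<open>\<alpha> - \<beta>\<close> decides domination because \<open>trace (A B) = \<plusminus>(2 - (\<alpha> - \<beta>)\<^sup>2)\<close>. If
  \<open>\<alpha> - \<beta> \<le> 2\<close>, this trace has absolute value at most 2, and then the powers of \<open>A B\<close> grow at most
  linearly, which excludes domination (\<open>dominated_imp_trace_product\<close>). If \<open>\<alpha> - \<beta> > 2\<close>, both matrices
  map the double cone of slopes in \<open>[-1, 0] \<union> [1, \<infinity>]\<close> into itself and expand the \<open>l\<^sup>1\<close> norm there by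
  a factor of at least \<open>min \<tau> ((\<alpha> - \<beta>) / 2) > 1\<close> (\<open>double_cone_step\<close>), which forces exponential growth
  of all products (\<open>dominated_if_expanding_set\<close>).
\<close>

section \<open>Operator norms induced by arbitrary norms on the plane\<close>

lemma vector_norm_equiv:
  assumes "is_vector_norm \<nu>"
  shows "\<exists>m>0. \<exists>K>0. \<forall>x. m * norm x \<le> \<nu> x \<and> \<nu> x \<le> K * norm x"
proof -
  have nonneg: "0 \<le> \<nu> x" and zero: "\<nu> x = 0 \<longleftrightarrow> x = 0"
    and scale: "\<nu> (c *\<^sub>R x) = \<bar>c\<bar> * \<nu> x" and tri: "\<nu> (x + y) \<le> \<nu> x + \<nu> y" for x y c
    using assms unfolding is_vector_norm_def by blast+
  define K where "K = \<nu> (axis 1 1) + \<nu> (axis 2 1) + 1"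
  have K: "K > 0" using nonneg[of "axis 1 1"] nonneg[of "axis 2 1"] by (simp add: K_def)
  have upper: "\<nu> x \<le> K * norm x" for x
  proof -
    have "x = x $ 1 *\<^sub>R axis 1 1 + x $ 2 *\<^sub>R axis 2 1"
      by (simp add: vec_eq_iff forall_2 axis_def)
    then have "\<nu> x \<le> \<bar>x $ 1\<bar> * \<nu> (axis 1 1) + \<bar>x $ 2\<bar> * \<nu> (axis 2 1)"
      using tri scale by metis
    also have "\<dots> \<le> norm x * \<nu> (axis 1 1) + norm x * \<nu> (axis 2 1)"
      by (intro add_mono mult_right_mono component_le_norm_cart nonneg)
    also have "\<dots> \<le> K * norm x" by (simp add: K_def algebra_simps)
    finally show ?thesis .
  qed
  have lip: "\<bar>\<nu> x - \<nu> y\<bar> \<le> K * norm (x - y)" for x y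
  proof -
    have "\<nu> x \<le> \<nu> y + \<nu> (x - y)" using tri[of y "x - y"] by simp
    moreover have "\<nu> y \<le> \<nu> x + \<nu> (x - y)"
      using tri[of x "y - x"] scale[of "-1" "x - y"] by simp
    ultimately show ?thesis using upper[of "x - y"] by linarith
  qed
  have "K-lipschitz_on UNIV \<nu>"
    using lip K by (intro lipschitz_onI) (auto simp: dist_norm)
  then have "continuous_on (sphere 0 1) \<nu>"
    using lipschitz_on_continuous_on continuous_on_subset by blast
  moreover have "sphere (0::real^2) 1 \<noteq> {}" by simp
  ultimately obtain z where z: "z \<in> sphere 0 1" "\<And>y. y \<in> sphere 0 1 \<Longrightarrow> \<nu> z \<le> \<nu> y"
    using continuous_attains_inf[OF compact_sphere] by blast
  have "\<nu> z > 0" using z(1) nonneg[of z] zero[of z] by fastforce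
  moreover have "\<nu> z * norm x \<le> \<nu> x" for x
  proof (cases "x = 0")
    case False
    then have "\<nu> z \<le> \<nu> ((1 / norm x) *\<^sub>R x)" by (intro z(2)) simp
    then show ?thesis using False scale[of "1 / norm x" x] by (simp add: field_simps)
  qed (simp add: nonneg)
  ultimately show ?thesis using K upper by blast
qed

text \<open>
  Supplies the boundedness without which the supremum defining the operator norm would be an
  unspecified real number.
\<close>

lemma vector_norm_quotient_le:
  assumes "is_vector_norm \<nu>"
  shows "\<exists>K>0. \<forall>A x. \<nu> (A *v x) / \<nu> x \<le> K * (\<Sum>i\<in>UNIV. \<Sum>j\<in>UNIV. \<bar>A $ i $ j\<bar>)"
proof -
  obtain m K where mK: "m > 0" "K > 0" "\<And>x. m * norm x \<le> \<nu> x" "\<And>x. \<nu> x \<le> K * norm x"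
    using vector_norm_equiv[OF assms] by blast
  have "\<nu> (A *v x) / \<nu> x \<le> K / m * (\<Sum>i\<in>UNIV. \<Sum>j\<in>UNIV. \<bar>A $ i $ j\<bar>)" (is "_ \<le> _ * ?s") for A x
  proof (cases "x = 0")
    case True
    then show ?thesis using assms mK by (simp add: is_vector_norm_def sum_nonneg)
  next
    case False
    have s: "?s \<ge> 0" by (simp add: sum_nonneg)
    have "\<nu> (A *v x) \<le> K * norm (A *v x)" by (rule mK)
    also have "\<dots> \<le> K * (?s * norm x)"
    proof -
      have "norm (A *v x) \<le> onorm ((*v) A) * norm x" by (rule onorm) simp
      also have "\<dots> \<le> ?s * norm x"
        by (intro mult_right_mono onorm_le_matrix_component_sum) simp
      finally show ?thesis using mK by simp
    qed
    also have "\<dots> = K / m * ?s * (m * norm x)" using mK by simp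
    also have "\<dots> \<le> K / m * ?s * \<nu> x" using mK s by (intro mult_left_mono) auto
    finally have "\<nu> (A *v x) \<le> K / m * ?s * \<nu> x" .
    moreover have "\<nu> x > 0" using mK(1) mK(3)[of x] False
      by (meson less_le_trans mult_pos_pos zero_less_norm_iff)
    ultimately show ?thesis by (simp add: pos_divide_le_eq)
  qed
  then show ?thesis using mK by (intro exI[of _ "K / m"]) auto
qed

lemma operator_norm_bound:
  assumes "is_vector_norm \<nu>"
  shows "\<nu> (A *v x) \<le> operator_norm \<nu> A * \<nu> x"
proof (cases "x = 0")
  case True
  moreover have "\<nu> 0 = 0" using assms by (simp add: is_vector_norm_def)
  ultimately show ?thesis by simp
next
  case False
  then have "\<nu> x > 0" using assms by (metis is_vector_norm_def less_eq_real_def)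
  moreover have "bdd_above ((\<lambda>x. \<nu> (A *v x) / \<nu> x) ` {x. x \<noteq> 0})"
    using vector_norm_quotient_le[OF assms] by (metis (no_types, lifting) bdd_aboveI2)
  then have "\<nu> (A *v x) / \<nu> x \<le> operator_norm \<nu> A"
    unfolding operator_norm_def using False by (intro cSUP_upper) auto
  ultimately show ?thesis by (simp add: pos_divide_le_eq)
qed

lemma operator_norm_le_entries:
  assumes "is_vector_norm \<nu>"
  shows "\<exists>K>0. \<forall>A. operator_norm \<nu> A \<le> K * (\<Sum>i\<in>UNIV. \<Sum>j\<in>UNIV. \<bar>A $ i $ j\<bar>)"
proof -
  obtain K where K: "K > 0"
    "\<And>A x. \<nu> (A *v x) / \<nu> x \<le> K * (\<Sum>i\<in>UNIV. \<Sum>j\<in>UNIV. \<bar>A $ i $ j\<bar>)"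
    using vector_norm_quotient_le[OF assms] by blast
  have "{x :: real^2. x \<noteq> 0} \<noteq> {}" using axis_eq_0_iff[of 1 "1::real"] by blast
  then have "operator_norm \<nu> A \<le> K * (\<Sum>i\<in>UNIV. \<Sum>j\<in>UNIV. \<bar>A $ i $ j\<bar>)" for A
    unfolding operator_norm_def using K(2) by (intro cSUP_least) auto
  with K(1) show ?thesis by blast
qed

section \<open>A sufficient and a necessary condition for domination\<close>

text \<open>
  A single vector witnesses the growth of every product: its orbit never leaves \<open>K\<close>, so \<open>f\<close> grows
  along it by the factor \<open>l\<close> at each step, and every norm is bounded below by a multiple of \<open>f\<close>.
\<close>

lemma dominated_if_expanding_set:
  fixes f :: "real^2 \<Rightarrow> real" and K :: "(real^2) set"
  assumes \<nu>: "is_vector_norm \<nu>" and S: "finite S" "S \<subseteq> SL2"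
    and inv: "\<And>A v. A \<in> S \<Longrightarrow> v \<in> K \<Longrightarrow> A *v v \<in> K"
    and expand: "\<And>A v. A \<in> S \<Longrightarrow> v \<in> K \<Longrightarrow> l * f v \<le> f (A *v v)"
    and l: "l > 1"
    and v0: "v0 \<in> K" "f v0 > 0"
    and le: "\<And>v. f v \<le> c * norm v"
  shows "dominated \<nu> S"
proof -
  obtain m where m: "m > 0" "\<And>x. m * norm x \<le> \<nu> x"
    using vector_norm_equiv[OF \<nu>] by blast
  have "norm v0 > 0" "c > 0"
  proof -
    have "0 < c * norm v0" using v0 le[of v0] by linarith
    then show "norm v0 > 0" "c > 0" by (auto simp: zero_less_mult_iff)
  qed
  then have \<nu>0: "\<nu> v0 > 0" using m by (meson less_le_trans mult_pos_pos)
  define C where "C = m * f v0 / (c * \<nu> v0)"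
  have "C * l ^ n \<le> operator_norm \<nu> (matrix_product M n)" if M: "\<forall>j. M j \<in> S" for M n
  proof -
    have "matrix_product M n *v v0 \<in> K \<and> l ^ n * f v0 \<le> f (matrix_product M n *v v0)"
    proof (induction n)
      case 0
      then show ?case using v0 by simp
    next
      case (Suc n)
      let ?w = "matrix_product M n *v v0"
      have "l ^ Suc n * f v0 \<le> l * f ?w" using Suc l by simp
      also have "\<dots> \<le> f (M n *v ?w)" using Suc M by (intro expand) auto
      finally show ?case using Suc M inv[of "M n" ?w] by (simp add: matrix_vector_mul_assoc)
    qed
    then have "m * (l ^ n * f v0) \<le> m * (c * norm (matrix_product M n *v v0))"
      using le[of "matrix_product M n *v v0"] m(1) by (intro mult_left_mono) auto
    also have "\<dots> = c * (m * norm (matrix_product M n *v v0))" by simp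
    also have "\<dots> \<le> c * \<nu> (matrix_product M n *v v0)"
      using m(2) \<open>c > 0\<close> by (intro mult_left_mono) auto
    also have "\<dots> \<le> c * (operator_norm \<nu> (matrix_product M n) * \<nu> v0)"
      using operator_norm_bound[OF \<nu>] \<open>c > 0\<close> by (intro mult_left_mono) auto
    finally show ?thesis using \<open>c > 0\<close> \<nu>0 by (simp add: C_def field_simps)
  qed
  moreover have "C > 0" using m v0 \<nu>0 \<open>c > 0\<close> by (simp add: C_def)
  ultimately show ?thesis unfolding dominated_def using S l by blast
qed

text \<open>
  The quadratic form \<open>E n = x\<^sub>n\<^sub>+\<^sub>1\<^sup>2 - s x\<^sub>n\<^sub>+\<^sub>1 x\<^sub>n + x\<^sub>n\<^sup>2\<close> is conserved and, for \<open>|s| \<le> 2\<close>, positive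
  semidefinite. Its square part bounds \<open>x\<^sub>n\<^sub>+\<^sub>1 - s/2 x\<^sub>n\<close>, hence the increment of \<open>|x\<^sub>n|\<close>, by a constant;
  this covers the parabolic case \<open>|s| = 2\<close>, where the growth really can be linear, without a case
  distinction.
\<close>

lemma recurrence_linear_growth:
  fixes x :: "nat \<Rightarrow> real"
  assumes rec: "\<And>n. x (Suc (Suc n)) = s * x (Suc n) - x n" and s: "\<bar>s\<bar> \<le> 2"
  obtains a b where "\<And>n. \<bar>x n\<bar> \<le> a + b * real n"
proof -
  define E where "E n = (x (Suc n))\<^sup>2 - s * x (Suc n) * x n + (x n)\<^sup>2" for n
  have E: "E n = E 0" for n
    by (induction n) (simp_all add: E_def rec power2_eq_square algebra_simps)
  have step: "\<bar>x (Suc n)\<bar> \<le> \<bar>x n\<bar> + sqrt (E 0)" for n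
  proof -
    have "s\<^sup>2 \<le> 2\<^sup>2" using s by (metis abs_le_square_iff abs_numeral)
    then have "0 \<le> (1 - s\<^sup>2 / 4) * (x n)\<^sup>2" by simp
    \<comment> \<open>completing the square in the conserved quantity\<close>
    then have "(x (Suc n) - s / 2 * x n)\<^sup>2 \<le> E n"
      by (simp add: E_def power2_eq_square algebra_simps)
    then have "\<bar>x (Suc n) - s / 2 * x n\<bar> \<le> sqrt (E 0)"
      by (metis E real_sqrt_abs real_sqrt_le_iff)
    moreover have "\<bar>s / 2 * x n\<bar> \<le> \<bar>x n\<bar>"
      using s mult_right_mono[of "\<bar>s\<bar>" 2 "\<bar>x n\<bar>"] by (simp add: abs_mult)
    ultimately show ?thesis by linarith
  qed
  have "\<bar>x n\<bar> \<le> \<bar>x 0\<bar> + sqrt (E 0) * real n" for n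
  proof (induction n)
    case (Suc n)
    then show ?case using step[of n] by (simp add: algebra_simps)
  qed simp
  then show thesis by (rule that)
qed

lemma cayley_hamilton_2:
  fixes M :: "real^2^2"
  shows "M ** M = trace M *\<^sub>R M - det M *\<^sub>R mat 1"
  by (simp add: vec_eq_iff forall_2 matrix_matrix_mult_def sum_2 det_2 trace_def mat_def algebra_simps)

lemma linear_below_exponential:
  fixes l :: real
  assumes "l > 1" "C > 0"
  obtains n where "a + b * real n < C * l ^ n"
proof -
  have "(\<lambda>n. (a + b * real n) / l ^ n) \<longlonglongrightarrow> 0"
  proof -
    have "(\<lambda>n. a * (1 / l) ^ n + b * (real n * (1 / l) ^ n)) \<longlonglongrightarrow> a * 0 + b * 0"
      using assms by (intro tendsto_intros LIMSEQ_power_zero powser_times_n_limit_0) auto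
    moreover have "(\<lambda>n. a * (1 / l) ^ n + b * (real n * (1 / l) ^ n)) = (\<lambda>n. (a + b * real n) / l ^ n)"
      using assms by (auto simp: field_simps)
    ultimately show ?thesis by simp
  qed
  from order_tendstoD(2)[OF this, of C] \<open>C > 0\<close>
  obtain n where "(a + b * real n) / l ^ n < C" by (auto simp: eventually_sequentially)
  then show thesis using assms by (intro that[of n]) (simp add: pos_divide_less_eq)
qed

text \<open>
  Along the periodic sequence \<open>B, A, B, A, \<dots>\<close> the entries of the products obey, by Cayley-Hamilton,
  a two-term recurrence with coefficient \<open>trace (A ** B)\<close>. Were its absolute value at most 2, they
  would grow at most linearly, against the exponential growth required by domination.
\<close>

lemma dominated_imp_trace_product:
  assumes \<nu>: "is_vector_norm \<nu>" and dom: "dominated \<nu> S" and AB: "A \<in> S" "B \<in> S"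
  shows "\<bar>trace (A ** B)\<bar> > 2"
proof (rule ccontr)
  assume small: "\<not> ?thesis"
  define M where "M j = (if even j then B else A)" for j :: nat
  define N where "N n = matrix_product M (2 * n)" for n
  define T where "T = A ** B"
  have "A \<in> SL2" "B \<in> SL2" using dom AB by (auto simp: dominated_def)
  then have "det T = 1" by (simp add: T_def SL2_def det_mul)
  have N_Suc: "N (Suc n) = T ** N n" for n
    by (simp add: N_def M_def T_def matrix_mul_assoc)
  have N_rec: "N (Suc (Suc n)) = trace T *\<^sub>R N (Suc n) - N n" for n
  proof -
    have "N (Suc (Suc n)) = (T ** T) ** N n" by (simp add: N_Suc matrix_mul_assoc)
    also have "\<dots> = trace T *\<^sub>R (T ** N n) - N n"
      unfolding cayley_hamilton_2 \<open>det T = 1\<close>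
      by (simp add: vec_eq_iff forall_2 matrix_matrix_mult_def sum_2 mat_def algebra_simps)
    finally show ?thesis by (simp add: N_Suc)
  qed
  have "\<exists>a b. \<forall>n. \<bar>N n $ i $ j\<bar> \<le> a + b * real n" for i j
    using recurrence_linear_growth[of "\<lambda>n. N n $ i $ j" "trace T"] small N_rec
    by (metis T_def linorder_not_less real_scaleR_def vector_minus_component vector_scaleR_component)
  then obtain a b where ab: "\<And>i j n. \<bar>N n $ i $ j\<bar> \<le> a i j + b i j * real n" by metis
  obtain K where K: "K > 0" "\<And>A. operator_norm \<nu> A \<le> K * (\<Sum>i\<in>UNIV. \<Sum>j\<in>UNIV. \<bar>A $ i $ j\<bar>)"
    using operator_norm_le_entries[OF \<nu>] by blast
  obtain C l where Cl: "C > 0" "l > 1"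
    "\<And>n. C * l ^ n \<le> operator_norm \<nu> (matrix_product M n)"
    using dom AB unfolding dominated_def M_def by (smt (verit))
  define a' b' where "a' = K * (\<Sum>i\<in>UNIV. \<Sum>j\<in>UNIV. a i j)" and "b' = K * (\<Sum>i\<in>UNIV. \<Sum>j\<in>UNIV. b i j)"
  have upper: "C * (l\<^sup>2) ^ n \<le> a' + b' * real n" for n
  proof -
    have "C * (l\<^sup>2) ^ n \<le> operator_norm \<nu> (N n)"
      using Cl(3)[of "2 * n"] by (simp add: N_def power_mult)
    also have "\<dots> \<le> K * (\<Sum>i\<in>UNIV. \<Sum>j\<in>UNIV. \<bar>N n $ i $ j\<bar>)" by (rule K)
    also have "\<dots> \<le> K * (\<Sum>i\<in>UNIV. \<Sum>j\<in>UNIV. a i j + b i j * real n)"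
      using K(1) by (intro mult_left_mono sum_mono ab) auto
    also have "\<dots> = a' + b' * real n"
      by (simp add: a'_def b'_def sum_2 algebra_simps)
    finally show ?thesis .
  qed
  have "l\<^sup>2 > 1" using Cl(2) by (simp add: one_less_power)
  then obtain n where "a' + b' * real n < C * (l\<^sup>2) ^ n"
    using linear_below_exponential Cl(1) by blast
  with upper[of n] show False by simp
qed

section \<open>Brackets, eigenlines and the cross-ratio\<close>

text \<open>The area form of the plane.\<close>

definition bracket :: "real^2 \<Rightarrow> real^2 \<Rightarrow> real" where
  "bracket v w = v $ 1 * w $ 2 - v $ 2 * w $ 1"

lemma bracket_linear:
  "bracket (v + v') w = bracket v w + bracket v' w"
  "bracket (v - v') w = bracket v w - bracket v' w"
  "bracket (c *\<^sub>R v) w = c * bracket v w"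
  "bracket v (w + w') = bracket v w + bracket v w'"
  "bracket v (w - w') = bracket v w - bracket v w'"
  "bracket v (c *\<^sub>R w) = c * bracket v w"
  "bracket v v = 0"
  by (simp_all add: bracket_def algebra_simps)

lemma bracket_flip: "bracket w v = - bracket v w"
  by (simp add: bracket_def)

lemma bracket_matrix: "bracket (A *v v) (A *v w) = det A * bracket v w"
  by (simp add: bracket_def det_2 matrix_vector_mult_def sum_2 algebra_simps)

text \<open>This computes traces in an arbitrary basis without a change-of-basis matrix.\<close>

lemma bracket_trace: "bracket (A *v v) w + bracket v (A *v w) = trace A * bracket v w"
  by (simp add: bracket_def trace_def matrix_vector_mult_def sum_2 algebra_simps)

text \<open>Cramer's rule for the coordinates of \<open>x\<close> with respect to \<open>v\<close> and \<open>w\<close>.\<close>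

lemma bracket_expand: "bracket v w *\<^sub>R x = bracket x w *\<^sub>R v + bracket v x *\<^sub>R w"
  by (simp add: vec_eq_iff forall_2 bracket_def algebra_simps)

lemma abs_bracket_le: "\<bar>bracket v w\<bar> \<le> 2 * norm v * norm w"
proof -
  have "\<bar>v $ 1 * w $ 2\<bar> \<le> norm v * norm w" "\<bar>v $ 2 * w $ 1\<bar> \<le> norm v * norm w"
    by (simp_all add: abs_mult mult_mono component_le_norm_cart)
  then show ?thesis by (simp add: bracket_def)
qed

lemma vec2_eq_0_iff: "v = 0 \<longleftrightarrow> v $ 1 = 0 \<and> v $ 2 = (0::real)" for v :: "real^2"
  by (simp add: vec_eq_iff forall_2)

lemma parallel_if_bracket_0:
  assumes "bracket u s = 0" "u \<noteq> 0"
  shows "\<exists>c. s = c *\<^sub>R u"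
proof (cases "u $ 1 = 0")
  case True
  then show ?thesis using assms
    by (intro exI[of _ "s $ 2 / u $ 2"]) (auto simp: vec_eq_iff forall_2 bracket_def)
next
  case False
  then show ?thesis using assms
    by (intro exI[of _ "s $ 1 / u $ 1"]) (auto simp: vec_eq_iff forall_2 bracket_def field_simps)
qed

lemma line_of_eq_iff:
  assumes "v \<noteq> 0" "w \<noteq> 0"
  shows "line_of v = line_of w \<longleftrightarrow> bracket v w = 0"
  using assms unfolding line_of_def bracket_def vec2_eq_0_iff
  by (cases "v $ 2 = 0"; cases "w $ 2 = 0") (simp_all add: frac_eq_eq mult.commute)

text \<open>
  A bracket factors through the affine difference: the scaling factor of each argument depends on
  that argument and its position only, so in a cross-ratio all scaling factors cancel.
\<close>

lemma bracket_rp1_diff: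
  assumes "v \<noteq> 0" "w \<noteq> 0" "line_of v \<noteq> line_of w"
  shows "bracket v w = (if v $ 2 = 0 then v $ 1 else v $ 2) * (if w $ 2 = 0 then - w $ 1 else w $ 2)
           * rp1_diff (line_of v) (line_of w)"
  using assms unfolding line_of_def bracket_def vec2_eq_0_iff
  by (cases "v $ 2 = 0"; cases "w $ 2 = 0") (simp_all add: right_diff_distrib)

lemma cross_ratio_bracket:
  assumes nz: "a \<noteq> 0" "a' \<noteq> 0" "b \<noteq> 0" "b' \<noteq> 0"
    and dirs: "u_dir A = line_of a" "s_dir A = line_of a'" "u_dir B = line_of b" "s_dir B = line_of b'"
    and "cross_ratio_defined A B" "cross_ratio A B \<noteq> 0"
  shows "cross_ratio A B = bracket a b * bracket a' b' / (bracket a b' * bracket a' b)"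
proof -
  define p where "p v = (if v $ 2 = 0 then v $ 1 else v $ 2)" for v :: "real^2"
  define q where "q v = (if v $ 2 = 0 then - v $ 1 else v $ 2)" for v :: "real^2"
  have pq: "p v \<noteq> 0" "q v \<noteq> 0" if "v \<noteq> 0" for v
    using that by (auto simp: p_def q_def vec2_eq_0_iff)
  have ne: "line_of a \<noteq> line_of b" "line_of a' \<noteq> line_of b'" "line_of a \<noteq> line_of b'" "line_of a' \<noteq> line_of b"
    using assms unfolding cross_ratio_defined_def cross_ratio_def by (auto split: if_splits)
  have br: "bracket v w = p v * q w * rp1_diff (line_of v) (line_of w)"
    if "v \<noteq> 0" "w \<noteq> 0" "line_of v \<noteq> line_of w" for v w
    using bracket_rp1_diff[OF that] by (simp add: p_def q_def)
  have "cross_ratio A B = rp1_diff (line_of a) (line_of b) / rp1_diff (line_of a) (line_of b') *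
           (rp1_diff (line_of a') (line_of b') / rp1_diff (line_of a') (line_of b))"
    using ne dirs by (simp add: cross_ratio_def)
  also have "\<dots> = bracket a b * bracket a' b' / (bracket a b' * bracket a' b)"
  proof -
    have cancel: "d1 / d3 * (d2 / d4) = (x * z * d1) * (y * w * d2) / ((x * w * d3) * (y * z * d4))"
      if "x \<noteq> 0" "y \<noteq> 0" "z \<noteq> 0" "w \<noteq> 0" for x y z w d1 d2 d3 d4 :: real
      using that by simp
    show ?thesis
      unfolding br[OF nz(1,3) ne(1)] br[OF nz(2,4) ne(2)] br[OF nz(1,4) ne(3)] br[OF nz(2,3) ne(4)]
      by (rule cancel) (use nz pq in auto)
  qed
  finally show ?thesis .
qed

lemma eigenvalue_iff_char_poly_root:
  fixes A :: "real^2^2"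
  shows "eigenvalue A l \<longleftrightarrow> l\<^sup>2 - trace A * l + det A = 0"
proof -
  let ?M = "A - l *\<^sub>R mat 1"
  have "det ?M = l\<^sup>2 - trace A * l + det A"
    by (simp add: det_2 trace_def sum_2 mat_def power2_eq_square algebra_simps)
  moreover have "det ?M \<noteq> 0 \<longleftrightarrow> (\<forall>v. ?M *v v = 0 \<longrightarrow> v = 0)"
    unfolding invertible_det_nz[symmetric] invertible_left_inverse by (rule matrix_left_invertible_ker)
  moreover have "?M *v v = 0 \<longleftrightarrow> A *v v = l *\<^sub>R v" for v
    by (simp add: matrix_vector_mult_diff_rdistrib scaleR_matrix_vector_assoc[symmetric])
  ultimately show ?thesis unfolding eigenvalue_def by metis
qed

text \<open>
  Two eigenvectors for \<open>l\<close> have a bracket that \<open>A\<close> both preserves and multiplies by \<open>l\<^sup>2\<close>; it vanishes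
  when \<open>l\<^sup>2 \<noteq> 1\<close>, so the eigenline is unique.
\<close>

lemma eigenline_eq:
  assumes "A \<in> SL2" "v \<noteq> 0" "A *v v = l *\<^sub>R v" "l\<^sup>2 \<noteq> 1"
  shows "eigenline A l = line_of v"
proof -
  have "line_of w = line_of v" if "w \<noteq> 0" "A *v w = l *\<^sub>R w" for w
  proof -
    have "l\<^sup>2 * bracket w v = bracket w v"
      using bracket_matrix[of A w v] assms that by (simp add: SL2_def bracket_linear power2_eq_square)
    then show ?thesis using assms that by (simp add: line_of_eq_iff)
  qed
  moreover have "\<exists>w. w \<noteq> 0 \<and> A *v w = l *\<^sub>R w \<and> line_of v = line_of w"
    using assms by blast
  ultimately show ?thesis unfolding eigenline_def by (intro the_equality) blast+
qed

text \<open>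
  With \<open>\<epsilon>\<close> the sign of the trace, the eigenvalues \<open>\<epsilon> (\<tau> \<plusminus> sqrt (\<tau>\<^sup>2 - 1))\<close> are the roots of the
  characteristic polynomial \<open>l\<^sup>2 - 2 \<epsilon> \<tau> l + 1\<close>.
\<close>

lemma hyperbolic_eigenvectors:
  assumes A: "hyperbolic A" and tr: "\<bar>trace A\<bar> = 2 * \<tau>"
  obtains \<epsilon> u s where "\<bar>\<epsilon>\<bar> = 1" "u \<noteq> 0" "s \<noteq> 0" "bracket u s \<noteq> 0"
    "A *v u = (\<epsilon> * (\<tau> + sqrt (\<tau>\<^sup>2 - 1))) *\<^sub>R u"
    "A *v s = (\<epsilon> * (\<tau> - sqrt (\<tau>\<^sup>2 - 1))) *\<^sub>R s"
    "u_dir A = line_of u" "s_dir A = line_of s"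
proof -
  have SL: "A \<in> SL2" and \<tau>: "\<tau> > 1" using A tr by (auto simp: hyperbolic_def)
  define \<epsilon> where "\<epsilon> = sgn (trace A)"
  have \<epsilon>: "\<bar>\<epsilon>\<bar> = 1" "\<epsilon> * \<epsilon> = 1" "trace A = \<epsilon> * (2 * \<tau>)"
    using tr \<tau> by (auto simp: \<epsilon>_def sgn_real_def split: if_splits)
  define \<mu> where "\<mu> = sqrt (\<tau>\<^sup>2 - 1)"
  have "\<tau>\<^sup>2 > 1" using \<tau> by (simp add: one_less_power)
  then have \<mu>: "\<mu> > 0" "\<mu>\<^sup>2 = \<tau>\<^sup>2 - 1" by (simp_all add: \<mu>_def)
  then have "\<mu> < \<tau>" using \<tau> by (intro power2_less_imp_less[of \<mu> \<tau>]) auto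
  define x y where "x = \<epsilon> * (\<tau> + \<mu>)" and "y = \<epsilon> * (\<tau> - \<mu>)"
  have "x + y = trace A" using \<epsilon> by (simp add: x_def y_def algebra_simps)
  have "x * y = (\<epsilon> * \<epsilon>) * (\<tau>\<^sup>2 - \<mu>\<^sup>2)"
    by (simp add: x_def y_def power2_eq_square algebra_simps)
  then have "x * y = 1" using \<epsilon> \<mu> by simp
  have xy: "\<bar>x\<bar> > \<bar>y\<bar>" "\<bar>x\<bar> > 1" "y \<noteq> 0"
    using \<epsilon> \<mu> \<tau> \<open>\<mu> < \<tau>\<close> by (auto simp: x_def y_def abs_mult)
  have sq: "x\<^sup>2 \<noteq> 1" "y\<^sup>2 \<noteq> 1"
  proof -
    show "x\<^sup>2 \<noteq> 1" using xy by (auto simp: power2_eq_1_iff)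
    then show "y\<^sup>2 \<noteq> 1" using \<open>x * y = 1\<close> by (metis mult_1_right power_mult_distrib power_one)
  qed
  have ev: "eigenvalue A l \<longleftrightarrow> l = x \<or> l = y" for l
  proof -
    have "l\<^sup>2 - trace A * l + det A = (l - x) * (l - y)"
      using SL \<open>x + y = trace A\<close> \<open>x * y = 1\<close>
      by (simp add: SL2_def power2_eq_square algebra_simps flip: \<open>x + y = trace A\<close>)
    then show ?thesis by (auto simp: eigenvalue_iff_char_poly_root)
  qed
  have "lambda_u A = x" "lambda_s A = y"
    unfolding lambda_u_def lambda_s_def by (intro the_equality; use ev xy in force)+
  moreover obtain u s where us: "u \<noteq> 0" "A *v u = x *\<^sub>R u" "s \<noteq> 0" "A *v s = y *\<^sub>R s"
    using ev[of x] ev[of y] by (auto simp: eigenvalue_def)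
  ultimately have "u_dir A = line_of u" "s_dir A = line_of s"
    using SL sq by (simp_all add: u_dir_def s_dir_def eigenline_eq)
  moreover have "bracket u s \<noteq> 0"
  proof
    assume "bracket u s = 0"
    then obtain c where c: "s = c *\<^sub>R u" using us parallel_if_bracket_0 by blast
    then have "(x - y) *\<^sub>R s = 0"
      using us by (simp add: matrix_vector_mult_scaleR scaleR_left_diff_distrib)
    then show False using us xy by auto
  qed
  ultimately show thesis
    using us \<epsilon>(1) by (intro that[of \<epsilon> u s]) (simp_all add: x_def y_def \<mu>_def)
qed

section \<open>A normal form for the pair\<close>

text \<open>
  If the eigenvalues of \<open>M\<close> are \<open>\<epsilon> (\<tau> \<plusminus> \<mu>)\<close>, the sum and the difference of two eigenvectors are swapped
  by the part of \<open>M\<close> that carries \<open>\<mu>\<close>. This is how equal diagonal entries \<open>\<tau>\<close> arise.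
\<close>

lemma eigenvectors_sum_diff:
  fixes M :: "real^'n^'n"
  assumes "M *v p = (\<epsilon> * (\<tau> + \<mu>)) *\<^sub>R p" "M *v q = (\<epsilon> * (\<tau> - \<mu>)) *\<^sub>R q"
  shows "M *v (p + q) = \<epsilon> *\<^sub>R (\<tau> *\<^sub>R (p + q) + \<mu> *\<^sub>R (p - q))"
    and "M *v (p - q) = \<epsilon> *\<^sub>R (\<tau> *\<^sub>R (p - q) + \<mu> *\<^sub>R (p + q))"
  unfolding matrix_vector_right_distrib[of M p q] matrix_vector_mult_diff_distrib[of M p q] assms
  by (simp_all add: algebra_simps)

text \<open>
  Put \<open>\<kappa> = sqrt C\<close>. Rescaling the unstable eigenvector of \<open>A\<close> to a suitable \<open>v\<close> puts the
  eigenlines of \<open>B\<close> in the symmetric position \<open>v + \<kappa> s\<close> and \<open>\<kappa> v + s\<close>: the ratio of their two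
  slopes is the cross-ratio, and the scaling makes the slopes inverse to each other. Then
  \<open>v \<plusminus> s\<close> are, up to factors, the sum and difference both of the eigenvectors of \<open>A\<close> and of those of
  \<open>B\<close>, so both matrices have diagonal entries \<open>\<plusminus>\<tau>\<close> in the basis of these two vectors. The relative
  length \<open>1 / k\<close> of the second one is chosen so that the quarter turn conjugates \<open>A\<close> to \<open>\<plusminus>B\<close>.
\<close>

lemma hyperbolic_pair_normal_form:
  assumes hyp: "hyperbolic A" "hyperbolic B"
    and cr: "cross_ratio_defined A B" "cross_ratio A B > 1"
    and tr: "\<bar>trace A\<bar> = 2 * \<tau>" "\<bar>trace B\<bar> = 2 * \<tau>"
  obtains e1 e2 \<alpha> \<beta> \<epsilon> \<delta> where "bracket e1 e2 \<noteq> 0" "\<bar>\<epsilon>\<bar> = 1" "\<bar>\<delta>\<bar> = 1"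
    "0 < \<beta>" "\<beta> < \<alpha>" "\<alpha> * \<beta> = \<tau>\<^sup>2 - 1"
    "(\<alpha> - \<beta>)\<^sup>2 * (cross_ratio A B - 1) = 4 * (\<tau>\<^sup>2 - 1)"
    "A *v e1 = \<epsilon> *\<^sub>R (\<tau> *\<^sub>R e1 + \<alpha> *\<^sub>R e2)" "A *v e2 = \<epsilon> *\<^sub>R (\<beta> *\<^sub>R e1 + \<tau> *\<^sub>R e2)"
    "B *v e1 = \<delta> *\<^sub>R (\<tau> *\<^sub>R e1 - \<beta> *\<^sub>R e2)" "B *v e2 = \<delta> *\<^sub>R (\<tau> *\<^sub>R e2 - \<alpha> *\<^sub>R e1)"
proof -
  define \<mu> where "\<mu> = sqrt (\<tau>\<^sup>2 - 1)"
  have "\<tau> > 1" using hyp tr by (auto simp: hyperbolic_def)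
  then have "\<tau>\<^sup>2 > 1" by (simp add: one_less_power)
  then have \<mu>: "\<mu> > 0" "\<mu> * \<mu> = \<tau>\<^sup>2 - 1" by (simp_all add: \<mu>_def)
  obtain \<epsilon> u s where us: "\<bar>\<epsilon>\<bar> = 1" "u \<noteq> 0" "s \<noteq> 0" "bracket u s \<noteq> 0"
    "A *v u = (\<epsilon> * (\<tau> + \<mu>)) *\<^sub>R u" "A *v s = (\<epsilon> * (\<tau> - \<mu>)) *\<^sub>R s"
    "u_dir A = line_of u" "s_dir A = line_of s"
    unfolding \<mu>_def by (rule hyperbolic_eigenvectors[OF hyp(1) tr(1)]) blast
  obtain \<delta> u' s' where us': "\<bar>\<delta>\<bar> = 1" "u' \<noteq> 0" "s' \<noteq> 0" "bracket u' s' \<noteq> 0"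
    "B *v u' = (\<delta> * (\<tau> + \<mu>)) *\<^sub>R u'" "B *v s' = (\<delta> * (\<tau> - \<mu>)) *\<^sub>R s'"
    "u_dir B = line_of u'" "s_dir B = line_of s'"
    unfolding \<mu>_def by (rule hyperbolic_eigenvectors[OF hyp(2) tr(2)]) blast
  define C where "C = cross_ratio A B"
  have C: "C = bracket u u' * bracket s s' / (bracket u s' * bracket s u')" "C > 1"
    using cross_ratio_bracket[of u s u' s' A B] us us' cr by (auto simp: C_def)
  then have nz: "bracket u u' \<noteq> 0" "bracket s s' \<noteq> 0" "bracket u s' \<noteq> 0" "bracket s u' \<noteq> 0"
    by auto
  define \<kappa> where "\<kappa> = sqrt C"
  have \<kappa>: "\<kappa> > 1" "\<kappa> * \<kappa> = C" using C(2) by (simp_all add: \<kappa>_def)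
  define p where "p = bracket u' s / bracket u u'"
  have pC: "p * C = bracket s' s / bracket u s'"
    using nz C by (simp add: p_def bracket_flip[of s s'] bracket_flip[of s u'] field_simps)
  \<comment> \<open>The eigenlines of \<open>B\<close> are spanned by \<open>p u + s\<close> and \<open>p C u + s\<close>; in terms of \<open>v\<close> the
    coefficients of the first vector become \<open>1 / \<kappa>\<close> and \<open>\<kappa>\<close>. The sign of \<open>p\<close>, which records the
    orientation of the configuration, is absorbed here as well.\<close>
  define v where "v = (p * \<kappa>) *\<^sub>R u"
  have "p \<noteq> 0" using nz bracket_flip[of s u'] by (simp add: p_def)
  then have vs: "bracket v s \<noteq> 0" using us \<kappa> by (simp add: v_def bracket_linear)
  have Av: "A *v v = (\<epsilon> * (\<tau> + \<mu>)) *\<^sub>R v"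
    using us by (simp add: v_def matrix_vector_mult_scaleR)
  have "v + \<kappa> *\<^sub>R s = (\<kappa> * bracket u s / bracket u u') *\<^sub>R u'"
  proof -
    have "(\<kappa> / bracket u u') *\<^sub>R (bracket u s *\<^sub>R u') = v + \<kappa> *\<^sub>R s"
      unfolding bracket_expand[of u s u'] using nz by (simp add: v_def p_def algebra_simps)
    then show ?thesis by simp
  qed
  then have Bu: "B *v (v + \<kappa> *\<^sub>R s) = (\<delta> * (\<tau> + \<mu>)) *\<^sub>R (v + \<kappa> *\<^sub>R s)"
    using us' by (simp add: matrix_vector_mult_scaleR)
  have "\<kappa> *\<^sub>R v + s = (bracket u s / bracket u s') *\<^sub>R s'"
  proof -
    have "(1 / bracket u s') *\<^sub>R (bracket u s *\<^sub>R s') = (p * C) *\<^sub>R u + s"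
      unfolding bracket_expand[of u s s'] using nz pC by (simp add: algebra_simps)
    then show ?thesis by (simp add: v_def algebra_simps flip: \<kappa>(2))
  qed
  then have Bs: "B *v (\<kappa> *\<^sub>R v + s) = (\<delta> * (\<tau> - \<mu>)) *\<^sub>R (\<kappa> *\<^sub>R v + s)"
    using us' by (simp add: matrix_vector_mult_scaleR)
  define k where "k = sqrt ((\<kappa> + 1) / (\<kappa> - 1))"
  have k: "k > 1" "k * k = (\<kappa> + 1) / (\<kappa> - 1)" using \<kappa> by (simp_all add: k_def)
  define e1 e2 where "e1 = v + s" and "e2 = (1 / k) *\<^sub>R (v - s)"
  have diff: "v - s = k *\<^sub>R e2" using k by (simp add: e2_def)
  define r c where "r = \<kappa> + 1" and "c = - (\<kappa> - 1) * k"
  have rc: "r \<noteq> 0" "c \<noteq> 0" "c = - (r / k)" "r = - (c * k)"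
    using \<kappa> k by (auto simp: r_def c_def field_simps)
  have sum': "(v + \<kappa> *\<^sub>R s) + (\<kappa> *\<^sub>R v + s) = r *\<^sub>R e1"
    by (simp add: r_def e1_def algebra_simps)
  have diff': "(v + \<kappa> *\<^sub>R s) - (\<kappa> *\<^sub>R v + s) = c *\<^sub>R e2"
  proof -
    have "(v + \<kappa> *\<^sub>R s) - (\<kappa> *\<^sub>R v + s) = (- (\<kappa> - 1)) *\<^sub>R (v - s)"
      by (simp add: algebra_simps)
    then show ?thesis by (simp add: diff c_def)
  qed
  note Bsum = eigenvectors_sum_diff[OF Bu Bs, unfolded sum' diff' matrix_vector_mult_scaleR]
  note Asum = eigenvectors_sum_diff[OF Av us(6), unfolded diff, folded e1_def]
  have "A *v e1 = \<epsilon> *\<^sub>R (\<tau> *\<^sub>R e1 + (k * \<mu>) *\<^sub>R e2)"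
    using Asum(1) by (simp add: mult.commute)
  moreover have "A *v e2 = \<epsilon> *\<^sub>R ((\<mu> / k) *\<^sub>R e1 + \<tau> *\<^sub>R e2)"
  proof -
    have "k *\<^sub>R (A *v e2) = k *\<^sub>R (\<epsilon> *\<^sub>R ((\<mu> / k) *\<^sub>R e1 + \<tau> *\<^sub>R e2))"
      using Asum(2) k by (simp add: matrix_vector_mult_scaleR algebra_simps)
    then show ?thesis by (rule scaleR_left_imp_eq[rotated]) (use k in simp)
  qed
  moreover have "B *v e1 = \<delta> *\<^sub>R (\<tau> *\<^sub>R e1 - (\<mu> / k) *\<^sub>R e2)"
  proof -
    have "r *\<^sub>R (B *v e1) = r *\<^sub>R (\<delta> *\<^sub>R (\<tau> *\<^sub>R e1 - (\<mu> / k) *\<^sub>R e2))"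
      unfolding Bsum(1) rc(3) by (simp add: algebra_simps)
    then show ?thesis by (rule scaleR_left_imp_eq[OF rc(1)])
  qed
  moreover have "B *v e2 = \<delta> *\<^sub>R (\<tau> *\<^sub>R e2 - (k * \<mu>) *\<^sub>R e1)"
  proof -
    have "c *\<^sub>R (B *v e2) = c *\<^sub>R (\<delta> *\<^sub>R (\<tau> *\<^sub>R e2 - (k * \<mu>) *\<^sub>R e1))"
      unfolding Bsum(2) rc(4) by (simp add: algebra_simps)
    then show ?thesis by (rule scaleR_left_imp_eq[OF rc(2)])
  qed
  moreover have "bracket e1 e2 \<noteq> 0"
    using vs k by (simp add: e1_def e2_def bracket_linear bracket_flip[of s v])
  moreover have "\<mu> / k < k * \<mu>" "0 < \<mu> / k" "(k * \<mu>) * (\<mu> / k) = \<tau>\<^sup>2 - 1"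
  proof -
    have "1 < k * k" using k(1) by (simp add: less_1_mult)
    then have "\<mu> * 1 < \<mu> * (k * k)" using \<mu> by (intro mult_strict_left_mono) auto
    then show "\<mu> / k < k * \<mu>" using k by (simp add: pos_divide_less_eq algebra_simps)
  qed (use k \<mu> in auto)
  moreover have "(k * \<mu> - \<mu> / k)\<^sup>2 * (C - 1) = 4 * (\<tau>\<^sup>2 - 1)"
  proof -
    have "(k * \<mu> - \<mu> / k)\<^sup>2 = (\<mu> * \<mu>) * (k * k - 2 + 1 / (k * k))"
    proof -
      have "k \<noteq> 0" using k by simp
      then show ?thesis by (simp add: power2_eq_square field_simps)
    qed
    moreover have "(k * k - 2 + 1 / (k * k)) * (C - 1) = 4"
    proof -
      have "\<kappa> - 1 \<noteq> 0" "\<kappa> + 1 \<noteq> 0" "C - 1 = (\<kappa> - 1) * (\<kappa> + 1)"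
        using \<kappa> by (auto simp: algebra_simps)
      then show ?thesis unfolding k(2) by (simp add: divide_simps) (simp add: algebra_simps)
    qed
    ultimately show ?thesis using \<mu>(2) by (simp only: mult.assoc)
  qed
  ultimately show thesis
    using us(1) us'(1) by (intro that[of e1 e2 \<epsilon> \<delta> "\<mu> / k" "k * \<mu>"]) (auto simp: C_def)
qed

section \<open>The invariant cone\<close>

text \<open>
  Around the unstable lines of \<open>A\<close> and \<open>B\<close>, which have the slopes \<open>sqrt (\<alpha> / \<beta>) > 1\<close> and
  \<open>- sqrt (\<beta> / \<alpha>)\<close> in the normal form, the cone has one component each: the slopes in \<open>[1, \<infinity>]\<close> and in
  \<open>[-1, 0]\<close>. The description by absolute values makes the invariance under sign changes and under the
  quarter turn visible.
\<close>

definition double_cone :: "real \<Rightarrow> real \<Rightarrow> bool" where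
  "double_cone a b \<longleftrightarrow> (\<bar>a\<bar> \<le> \<bar>b\<bar> \<and> 0 \<le> a * b) \<or> (\<bar>b\<bar> \<le> \<bar>a\<bar> \<and> a * b \<le> 0)"

lemma double_cone_uminus: "double_cone (- a) (- b) \<longleftrightarrow> double_cone a b"
  by (simp add: double_cone_def)

lemma double_cone_rotate: "double_cone (- b) a \<longleftrightarrow> double_cone a b"
  by (auto simp: double_cone_def mult.commute)

lemma double_cone_cases:
  assumes "double_cone a b"
  obtains "0 \<le> a" "a \<le> b" | "b \<le> 0" "- b \<le> a" | "a \<le> 0" "b \<le> a" | "0 \<le> b" "b \<le> - a"
  using assms unfolding double_cone_def by (auto simp: zero_le_mult_iff mult_le_0_iff)

text \<open>
  All claims are linear on each component of the cone, so they need checking on the boundary rays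
  \<open>(0, 1)\<close>, \<open>(1, 1)\<close>, \<open>(1, 0)\<close>, \<open>(1, -1)\<close> only, where invariance amounts to \<open>\<beta> \<le> \<tau> \<le> \<alpha>\<close> and
  \<open>2 \<tau> \<le> \<alpha> + \<beta>\<close>. The ray \<open>(1, -1)\<close> is critical: its image \<open>(\<tau> - \<beta>, \<alpha> - \<tau>)\<close> lies in the cone if
  \<open>2 \<tau> \<le> \<alpha> + \<beta>\<close>, equivalently \<open>\<alpha> - \<beta> \<ge> 2\<close>, and has \<open>l\<^sup>1\<close> norm \<open>\<alpha> - \<beta>\<close>, against the norm 2
  of \<open>(1, -1)\<close>.
\<close>

lemma double_cone_step:
  fixes \<alpha> \<beta> \<tau> l :: real
  assumes \<tau>: "1 < \<tau>" and \<beta>: "0 < \<beta>" and gap: "2 < \<alpha> - \<beta>" and prod: "\<alpha> * \<beta> = \<tau>\<^sup>2 - 1"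
    and l: "l \<le> \<tau>" "2 * l \<le> \<alpha> - \<beta>"
    and "double_cone a b"
  defines "a' \<equiv> \<tau> * a + \<beta> * b" and "b' \<equiv> \<alpha> * a + \<tau> * b"
  shows "double_cone a' b' \<and> l * (\<bar>a\<bar> + \<bar>b\<bar>) \<le> \<bar>a'\<bar> + \<bar>b'\<bar>"
proof -
  have \<beta>\<tau>: "\<beta> \<le> \<tau>"
  proof -
    have "\<beta> * \<beta> \<le> \<alpha> * \<beta>" using gap \<beta> by (intro mult_right_mono) auto
    then have "\<beta>\<^sup>2 \<le> \<tau>\<^sup>2" using prod by (simp add: power2_eq_square)
    then show ?thesis using \<tau> by (intro power2_le_imp_le[of \<beta> \<tau>]) auto
  qed
  have \<tau>\<alpha>: "\<tau> \<le> \<alpha>"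
  proof -
    have "(\<beta> + 2) * \<alpha> \<le> \<alpha> * \<alpha>" using gap \<beta> by (intro mult_right_mono) auto
    then have "\<tau>\<^sup>2 \<le> (\<alpha> - 1)\<^sup>2" using prod by (simp add: power2_eq_square algebra_simps)
    then have "\<tau> \<le> \<alpha> - 1" using gap \<beta> by (intro power2_le_imp_le[of \<tau>]) auto
    then show ?thesis by simp
  qed
  have sum: "2 * \<tau> \<le> \<alpha> + \<beta>"
  proof -
    have "2\<^sup>2 \<le> (\<alpha> - \<beta>)\<^sup>2" using gap by (intro power_mono) auto
    then have "(2 * \<tau>)\<^sup>2 \<le> (\<alpha> + \<beta>)\<^sup>2" using prod by (simp add: power2_eq_square algebra_simps)
    then show ?thesis using gap \<beta> by (intro power2_le_imp_le[of "2 * \<tau>"]) auto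
  qed
  have lower: "0 \<le> \<tau> * x + \<beta> * y \<and> \<tau> * x + \<beta> * y \<le> \<alpha> * x + \<tau> * y \<and>
      l * (\<bar>x\<bar> + \<bar>y\<bar>) \<le> (\<tau> * x + \<beta> * y) + (\<alpha> * x + \<tau> * y)"
    if "0 \<le> x \<and> x \<le> y \<or> y \<le> 0 \<and> - y \<le> x" for x y
    using that
  proof
    assume xy: "0 \<le> x \<and> x \<le> y"
    \<comment> \<open>coordinates along the boundary rays \<open>(1, 1)\<close> and \<open>(0, 1)\<close>\<close>
    define z where "z = y - x"
    have y: "y = x + z" and "0 \<le> x" "0 \<le> z" using xy by (auto simp: z_def)
    then have "0 \<le> (\<tau> + \<beta>) * x" "0 \<le> \<beta> * z" "0 \<le> (\<alpha> - \<beta>) * x" "0 \<le> (\<tau> - \<beta>) * z"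
      "0 \<le> (2 * \<tau> + \<alpha> + \<beta> - 2 * l) * x" "0 \<le> (\<tau> + \<beta> - l) * z"
      using \<tau> \<beta> gap \<beta>\<tau> l by auto
    then show ?thesis using xy unfolding y by (auto simp: algebra_simps)
  next
    assume xy: "y \<le> 0 \<and> - y \<le> x"
    \<comment> \<open>coordinates along the boundary rays \<open>(1, -1)\<close> and \<open>(1, 0)\<close>\<close>
    define w z where "w = - y" and "z = x + y"
    have x: "x = w + z" "y = - w" and "0 \<le> w" "0 \<le> z" using xy by (auto simp: w_def z_def)
    then have "0 \<le> \<tau> * z" "0 \<le> (\<tau> - \<beta>) * w" "0 \<le> (\<alpha> - \<tau>) * z" "0 \<le> (\<alpha> + \<beta> - 2 * \<tau>) * w"
      "0 \<le> (\<tau> + \<alpha> - l) * z" "0 \<le> (\<alpha> - \<beta> - 2 * l) * w"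
      using \<tau> \<beta> gap \<beta>\<tau> \<tau>\<alpha> sum l by auto
    then show ?thesis using \<open>0 \<le> w\<close> \<open>0 \<le> z\<close> unfolding x by (auto simp: algebra_simps)
  qed
  have pos: "double_cone (\<tau> * x + \<beta> * y) (\<alpha> * x + \<tau> * y) \<and>
      l * (\<bar>x\<bar> + \<bar>y\<bar>) \<le> \<bar>\<tau> * x + \<beta> * y\<bar> + \<bar>\<alpha> * x + \<tau> * y\<bar>"
    if "0 \<le> x \<and> x \<le> y \<or> y \<le> 0 \<and> - y \<le> x" for x y
    using lower[OF that] unfolding double_cone_def by (auto intro!: mult_nonneg_nonneg)
  have neg: "\<tau> * (- a) + \<beta> * (- b) = - a'" "\<alpha> * (- a) + \<tau> * (- b) = - b'"
    by (simp_all add: a'_def b'_def)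
  from \<open>double_cone a b\<close> consider "0 \<le> a \<and> a \<le> b \<or> b \<le> 0 \<and> - b \<le> a"
    | "0 \<le> - a \<and> - a \<le> - b \<or> - b \<le> 0 \<and> - (- b) \<le> - a"
    by (cases rule: double_cone_cases) auto
  then show ?thesis
  proof cases
    case 1
    then show ?thesis using pos[of a b] by (simp add: a'_def b'_def)
  next
    case 2
    then show ?thesis using pos[of "- a" "- b"] unfolding neg double_cone_uminus by simp
  qed
qed

section \<open>Domination of the pair\<close>

lemma dominated_normal_form:
  assumes \<nu>: "is_vector_norm \<nu>" and SL: "A \<in> SL2" "B \<in> SL2"
    and basis: "bracket e1 e2 \<noteq> 0" and sign: "\<bar>\<epsilon>\<bar> = 1" "\<bar>\<delta>\<bar> = 1"
    and \<tau>: "1 < \<tau>" and \<beta>: "0 < \<beta>" and gap: "2 < \<alpha> - \<beta>" and prod: "\<alpha> * \<beta> = \<tau>\<^sup>2 - 1"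
    and A: "A *v e1 = \<epsilon> *\<^sub>R (\<tau> *\<^sub>R e1 + \<alpha> *\<^sub>R e2)" "A *v e2 = \<epsilon> *\<^sub>R (\<beta> *\<^sub>R e1 + \<tau> *\<^sub>R e2)"
    and B: "B *v e1 = \<delta> *\<^sub>R (\<tau> *\<^sub>R e1 - \<beta> *\<^sub>R e2)" "B *v e2 = \<delta> *\<^sub>R (\<tau> *\<^sub>R e2 - \<alpha> *\<^sub>R e1)"
  shows "dominated \<nu> {A, B}"
proof -
  define l where "l = min \<tau> ((\<alpha> - \<beta>) / 2)"
  have l: "l > 1" "l \<le> \<tau>" "2 * l \<le> \<alpha> - \<beta>" using \<tau> gap by (simp_all add: l_def min_def)
  define K where "K = {a *\<^sub>R e1 + b *\<^sub>R e2 | a b. double_cone a b}"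
  \<comment> \<open>\<open>f\<close> is the \<open>l\<^sup>1\<close> norm of the coordinates in the basis, up to the factor \<open>|bracket e1 e2|\<close>\<close>
  define f where "f v = \<bar>bracket v e2\<bar> + \<bar>bracket e1 v\<bar>" for v
  have f: "f (a *\<^sub>R e1 + b *\<^sub>R e2) = (\<bar>a\<bar> + \<bar>b\<bar>) * \<bar>bracket e1 e2\<bar>" for a b
    by (simp add: f_def bracket_linear abs_mult distrib_right)
  have step: "M *v v \<in> K \<and> l * f v \<le> f (M *v v)" if "M \<in> {A, B}" "v \<in> K" for M v
  proof -
    obtain a b where v: "v = a *\<^sub>R e1 + b *\<^sub>R e2" "double_cone a b"
      using \<open>v \<in> K\<close> unfolding K_def by blast
    have "\<exists>a' b'. M *v v = a' *\<^sub>R e1 + b' *\<^sub>R e2 \<and> double_cone a' b' \<and> l * (\<bar>a\<bar> + \<bar>b\<bar>) \<le> \<bar>a'\<bar> + \<bar>b'\<bar>"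
    proof -
      have signed: "double_cone (c * x) (c * y) \<and> \<bar>c * x\<bar> + \<bar>c * y\<bar> = \<bar>x\<bar> + \<bar>y\<bar>"
        if "double_cone x y" "\<bar>c\<bar> = 1" for c x y
        using that double_cone_uminus[of x y] by (auto simp: abs_if split: if_splits)
      consider "M = A" | "M = B" using \<open>M \<in> {A, B}\<close> by blast
      then show ?thesis
      proof cases
        case 1
        let ?a = "\<tau> * a + \<beta> * b" and ?b = "\<alpha> * a + \<tau> * b"
        have "M *v v = (\<epsilon> * ?a) *\<^sub>R e1 + (\<epsilon> * ?b) *\<^sub>R e2"
          unfolding 1 v by (simp add: A matrix_vector_right_distrib matrix_vector_mult_scaleR algebra_simps)
        then show ?thesis
          using double_cone_step[OF \<tau> \<beta> gap prod l(2,3) v(2)] signed[of ?a ?b \<epsilon>] sign by fastforce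
      next
        case 2
        \<comment> \<open>conjugation by the quarter turn \<open>(a, b) \<mapsto> (- b, a)\<close> turns this case into the previous one\<close>
        let ?a = "\<tau> * b + \<beta> * (- a)" and ?b = "\<alpha> * b + \<tau> * (- a)"
        have "double_cone b (- a)" using v(2) double_cone_rotate[of "- a" b] double_cone_uminus[of a b] by simp
        from double_cone_step[OF \<tau> \<beta> gap prod l(2,3) this]
        have "double_cone (- ?b) ?a" "l * (\<bar>a\<bar> + \<bar>b\<bar>) \<le> \<bar>- ?b\<bar> + \<bar>?a\<bar>"
          unfolding double_cone_rotate abs_minus_cancel by (simp_all add: add.commute)
        moreover have "M *v v = (\<delta> * (- ?b)) *\<^sub>R e1 + (\<delta> * ?a) *\<^sub>R e2"
          unfolding 2 v by (simp add: B matrix_vector_right_distrib matrix_vector_mult_scaleR algebra_simps)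
        ultimately show ?thesis using signed[of "- ?b" ?a \<delta>] sign by fastforce
      qed
    qed
    then obtain a' b' where ab: "M *v v = a' *\<^sub>R e1 + b' *\<^sub>R e2" "double_cone a' b'"
      "l * (\<bar>a\<bar> + \<bar>b\<bar>) \<le> \<bar>a'\<bar> + \<bar>b'\<bar>"
      by blast
    have "l * f v \<le> f (M *v v)"
      unfolding ab(1) unfolding v(1) f using mult_right_mono[OF ab(3), of "\<bar>bracket e1 e2\<bar>"] by (simp add: mult.assoc)
    then show ?thesis using ab by (auto simp: K_def)
  qed
  show ?thesis
  proof (rule dominated_if_expanding_set[of \<nu> "{A, B}" K l f e1 "2 * norm e2 + 2 * norm e1"])
    show "e1 \<in> K" unfolding K_def double_cone_def by (intro CollectI exI[of _ 1] exI[of _ 0]) simp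
    show "f e1 > 0" using f[of 1 0] basis by simp
    show "f v \<le> (2 * norm e2 + 2 * norm e1) * norm v" for v
      using abs_bracket_le[of v e2] abs_bracket_le[of e1 v] by (simp add: f_def algebra_simps)
  qed (use \<nu> SL l step in auto)
qed

lemma trace_product_normal_form:
  assumes basis: "bracket e1 e2 \<noteq> 0" and prod: "\<alpha> * \<beta> = \<tau>\<^sup>2 - 1"
    and A: "A *v e1 = \<epsilon> *\<^sub>R (\<tau> *\<^sub>R e1 + \<alpha> *\<^sub>R e2)" "A *v e2 = \<epsilon> *\<^sub>R (\<beta> *\<^sub>R e1 + \<tau> *\<^sub>R e2)"
    and B: "B *v e1 = \<delta> *\<^sub>R (\<tau> *\<^sub>R e1 - \<beta> *\<^sub>R e2)" "B *v e2 = \<delta> *\<^sub>R (\<tau> *\<^sub>R e2 - \<alpha> *\<^sub>R e1)"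
  shows "trace (A ** B) = \<epsilon> * \<delta> * (2 - (\<alpha> - \<beta>)\<^sup>2)"
proof -
  have "bracket ((A ** B) *v e1) e2 = \<epsilon> * \<delta> * (\<tau>\<^sup>2 - \<beta>\<^sup>2) * bracket e1 e2"
    by (simp add: A B matrix_vector_mul_assoc[symmetric] matrix_vector_mult_diff_distrib
        matrix_vector_mult_scaleR bracket_linear power2_eq_square algebra_simps)
  moreover have "bracket e1 ((A ** B) *v e2) = \<epsilon> * \<delta> * (\<tau>\<^sup>2 - \<alpha>\<^sup>2) * bracket e1 e2"
    by (simp add: A B matrix_vector_mul_assoc[symmetric] matrix_vector_mult_diff_distrib
        matrix_vector_mult_scaleR bracket_linear power2_eq_square algebra_simps)
  ultimately have "trace (A ** B) * bracket e1 e2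
      = (\<epsilon> * \<delta> * ((\<tau>\<^sup>2 - \<beta>\<^sup>2) + (\<tau>\<^sup>2 - \<alpha>\<^sup>2))) * bracket e1 e2"
    using bracket_trace[of "A ** B" e1 e2] by (simp add: algebra_simps)
  moreover have "(\<tau>\<^sup>2 - \<beta>\<^sup>2) + (\<tau>\<^sup>2 - \<alpha>\<^sup>2) = 2 - (\<alpha> - \<beta>)\<^sup>2"
    using prod by (simp add: power2_eq_square algebra_simps)
  ultimately show ?thesis using basis by simp
qed

theorem theorem1p5:
  fixes A B :: "real^2^2" and t :: real and \<nu> :: "real^2 \<Rightarrow> real"
  assumes "is_vector_norm \<nu>"
    and "A \<in> SL2" and "B \<in> SL2"
    and "hyperbolic A" and "hyperbolic B"
    and "cross_ratio_defined A B" and "cross_ratio A B > 1"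
    and "\<bar>trace A\<bar> = t" and "\<bar>trace B\<bar> = t"
  shows "dominated \<nu> {A, B} \<longleftrightarrow> t / 2 > sqrt (cross_ratio A B)"
proof -
  define \<tau> where "\<tau> = t / 2"
  let ?C = "cross_ratio A B"
  have tr: "\<bar>trace A\<bar> = 2 * \<tau>" "\<bar>trace B\<bar> = 2 * \<tau>" using assms by (simp_all add: \<tau>_def)
  have \<tau>: "\<tau> > 1" using assms(4) tr(1) by (simp add: hyperbolic_def)
  obtain e1 e2 \<alpha> \<beta> \<epsilon> \<delta> where nf: "bracket e1 e2 \<noteq> 0" "\<bar>\<epsilon>\<bar> = 1" "\<bar>\<delta>\<bar> = 1"
    "0 < \<beta>" "\<beta> < \<alpha>" "\<alpha> * \<beta> = \<tau>\<^sup>2 - 1" "(\<alpha> - \<beta>)\<^sup>2 * (?C - 1) = 4 * (\<tau>\<^sup>2 - 1)"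
    "A *v e1 = \<epsilon> *\<^sub>R (\<tau> *\<^sub>R e1 + \<alpha> *\<^sub>R e2)" "A *v e2 = \<epsilon> *\<^sub>R (\<beta> *\<^sub>R e1 + \<tau> *\<^sub>R e2)"
    "B *v e1 = \<delta> *\<^sub>R (\<tau> *\<^sub>R e1 - \<beta> *\<^sub>R e2)" "B *v e2 = \<delta> *\<^sub>R (\<tau> *\<^sub>R e2 - \<alpha> *\<^sub>R e1)"
    by (rule hyperbolic_pair_normal_form[OF assms(4-7) tr]) blast
  have "dominated \<nu> {A, B} \<longleftrightarrow> 2 < \<alpha> - \<beta>"
  proof
    assume "dominated \<nu> {A, B}"
    then have "2 < \<bar>trace (A ** B)\<bar>"
      using assms(1) by (intro dominated_imp_trace_product) auto
    also have "\<dots> = \<bar>2 - (\<alpha> - \<beta>)\<^sup>2\<bar>"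
      using nf(2,3) by (simp add: trace_product_normal_form[OF nf(1,6,8-11)] abs_mult)
    finally have "2\<^sup>2 < (\<alpha> - \<beta>)\<^sup>2" using zero_le_power2[of "\<alpha> - \<beta>"] by (simp add: abs_if split: if_splits)
    then show "2 < \<alpha> - \<beta>" using nf(5) by (intro power2_less_imp_less[of 2]) auto
  next
    assume "2 < \<alpha> - \<beta>"
    then show "dominated \<nu> {A, B}"
      using dominated_normal_form[OF assms(1-3) nf(1-3) \<tau> nf(4) _ nf(6,8-11)] by blast
  qed
  also have "\<dots> \<longleftrightarrow> 2\<^sup>2 < (\<alpha> - \<beta>)\<^sup>2"
    using nf(5) power_strict_mono[of 2 "\<alpha> - \<beta>" 2] power2_less_imp_less[of 2 "\<alpha> - \<beta>"] by auto
  also have "\<dots> \<longleftrightarrow> 4 * (?C - 1) < (\<alpha> - \<beta>)\<^sup>2 * (?C - 1)"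
    using assms(7) by (subst mult_less_cancel_right_pos) simp_all
  also have "\<dots> \<longleftrightarrow> ?C < \<tau>\<^sup>2" unfolding nf(7) by simp
  also have "\<dots> \<longleftrightarrow> sqrt ?C < \<tau>"
    using \<tau> assms(7) by (metis abs_of_pos less_trans real_sqrt_abs real_sqrt_less_iff zero_less_one)
  finally show ?thesis by (simp add: \<tau>_def)
qed

end
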